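(* Let $U,V\subseteq\mathbb{R}^n$ be linear subspaces with $V\not\subset U$, with Friedrichs angle $\theta_F\in(0,\pi/2]$ and largest principal angle $\theta_p\in[\theta_F,\pi/2]$. With $a=\sin^2\theta_F\in(0,1]$, $b=\sin^2\theta_p\in[a,1]$, $c_F=\cos\theta_F$ and $\rho_V=\dfrac{b-a}{a+b}$, $$c_F^2-\rho_V=\frac{a(2-a-b)}{a+b}\ge 0,$$ with equality (to $0$) if and only if $a=b=1$ (i.e. $\theta_F=\theta_p=\pi/2$). In particular, $\rho_V<c_F^2$ whenever $\theta_F<\pi/2$.
   Context: $P_W$ denotes orthogonal projection onto a linear subspace $W$. With $p=\dim V$ and $s=\dim(U\cap V)<p$, let $\sigma_1\ge\dots\ge\sigma_p\ge0$ be the singular values of $P_U|_V:V\to\mathbb{R}^n$. The principal angles are $\theta_k=\arccos\sigma_k$, $0\le\theta_1\le\dots\le\theta_p\le\pi/2$; the first $s$ are $0$, and the Friedrichs angle is $\theta_F:=\theta_{s+1}\in(0,\pi/2]$. *)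

theory Defs
  imports "HOL-Analysis.Analysis"
begin

definition orth_proj :: "'a::euclidean_space set \<Rightarrow> 'a \<Rightarrow> 'a" where
  "orth_proj W x = (THE y. y \<in> W \<and> (\<forall>w\<in>W. orthogonal (x - y) w))"

(* Singular values are defined for the restriction of T to a subspace V, viewed as a
   linear map between the inner product spaces V and 'b; the behaviour of T outside V
   is irrelevant. The adjoint of this restriction maps 'b into V. *)

definition adjoint_on ::
    "'a::euclidean_space set \<Rightarrow> ('a \<Rightarrow> 'b::euclidean_space) \<Rightarrow> 'b \<Rightarrow> 'a" where
  "adjoint_on V T y = (THE z. z \<in> V \<and> (\<forall>x\<in>V. T x \<bullet> y = x \<bullet> z))"

definition singular_space ::
    "'a::euclidean_space set \<Rightarrow> ('a \<Rightarrow> 'b::euclidean_space) \<Rightarrow> real \<Rightarrow> 'a set" where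
  "singular_space V T t = {x \<in> V. adjoint_on V T (T x) = t\<^sup>2 *\<^sub>R x}"

(* The nonnegative square roots of the eigenvalues of T* T on V in decreasing order, each
   repeated according to its multiplicity. For linear T the set of these square roots is
   finite and the list has length dim V. *)

definition singular_values ::
    "'a::euclidean_space set \<Rightarrow> ('a \<Rightarrow> 'b::euclidean_space) \<Rightarrow> real list" where
  "singular_values V T =
     concat (map (\<lambda>t. replicate (dim (singular_space V T t)) t)
       (rev (sorted_list_of_set {t. 0 \<le> t \<and> (\<exists>x\<in>singular_space V T t. x \<noteq> 0)})))"

(* The index k ranges over 1, ..., dim V, whereas list positions start at 0. *)

definition principal_angle ::
    "'a::euclidean_space set \<Rightarrow> 'a set \<Rightarrow> nat \<Rightarrow> real" where
  "principal_angle U V k = arccos (singular_values V (orth_proj U) ! (k - 1))"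

definition friedrichs_angle ::
    "'a::euclidean_space set \<Rightarrow> 'a set \<Rightarrow> real" where
  "friedrichs_angle U V = principal_angle U V (dim (U \<inter> V) + 1)"

definition largest_principal_angle ::
    "'a::euclidean_space set \<Rightarrow> 'a set \<Rightarrow> real" where
  "largest_principal_angle U V = principal_angle U V (dim V)"

end

theory Submission
  imports Defs
begin

text \<open>
  Once the two angles are known to be arccosines of numbers \<open>c\<close> and \<open>d\<close> with
  \<open>0 \<le> d \<le> c < 1\<close>, the result is algebra: \<open>a = 1 - c\<^sup>2\<close> and \<open>b = 1 - d\<^sup>2\<close> satisfy
  \<open>0 < a \<le> b \<le> 1\<close>, and \<open>(1 - a) * (a + b) - (b - a) = a * (2 - a - b)\<close>, where the last
  factor is a sum of the nonnegative numbers \<open>1 - a\<close> and \<open>1 - b\<close>.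

  The substance lies in the bounds for \<open>c\<close> and \<open>d\<close>, which are entries of the list of singular
  values of the projection \<open>P\<close> onto \<open>U\<close> restricted to \<open>V\<close>. Three things are needed.

  \<^item> The list must be long enough for the entries to be singular values at all. This is the
    spectral theorem for the Gram operator \<open>T\<^sup>* T\<close> on \<open>V\<close> (\<open>span_singular_spaces\<close>), which
    rests on the existence of one eigenvector of a symmetric operator, obtained by maximising the
    Rayleigh quotient (\<open>symmetric_operator_has_eigenvector\<close>). The eigenspaces span \<open>V\<close>,
    so their dimensions add up to at least \<open>dim V\<close>.

  \<^item> A vector \<open>x\<close> of the eigenspace for the singular value \<open>t\<close> satisfies
    \<open>norm (P x) = t * norm x\<close>. By Pythagoras \<open>t \<le> 1\<close>, and if \<open>t = 1\<close> then
    \<open>x\<close> lies in \<open>U \<inter> V\<close>.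

  \<^item> Hence the value 1 occurs at most \<open>dim (U \<inter> V)\<close> times. As the list decreases, the entry
    after the first \<open>dim (U \<inter> V)\<close> entries is strictly below 1
    (\<open>singular_value_Friedrichs_less_1\<close>), and so the Friedrichs angle is positive.
\<close>

section \<open>Orthogonal projections and adjoints of restrictions\<close>

lemma orth_proj_ex1:
  fixes W :: "'a::euclidean_space set"
  assumes "subspace W"
  shows "\<exists>!y. y \<in> W \<and> (\<forall>w\<in>W. orthogonal (x - y) w)"
proof (rule ex_ex1I)
  obtain y z where "y \<in> span W" "\<And>w. w \<in> span W \<Longrightarrow> orthogonal z w" "x = y + z"
    using orthogonal_subspace_decomp_exists[of W x] by blast
  then show "\<exists>y. y \<in> W \<and> (\<forall>w\<in>W. orthogonal (x - y) w)"
    by (metis add_diff_cancel_left' assms span_eq_iff)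
next
  fix y z
  assume y: "y \<in> W \<and> (\<forall>w\<in>W. orthogonal (x - y) w)"
    and z: "z \<in> W \<and> (\<forall>w\<in>W. orthogonal (x - z) w)"
  then have "y - z \<in> W"
    using assms by (blast intro: subspace_diff)
  with y z have "(x - z) \<bullet> (y - z) - (x - y) \<bullet> (y - z) = 0"
    by (simp add: orthogonal_def)
  then have "(y - z) \<bullet> (y - z) = 0"
    by (simp add: inner_diff_left)
  then show "y = z" by simp
qed

lemma
  assumes "subspace W"
  shows orth_proj_in: "orth_proj W x \<in> W"
    and orth_proj_orthogonal: "w \<in> W \<Longrightarrow> (x - orth_proj W x) \<bullet> w = 0"
  using theI'[OF orth_proj_ex1[OF assms, of x]]
  by (auto simp: orth_proj_def orthogonal_def)

lemma orth_proj_unique: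
  assumes "subspace W" "y \<in> W" "\<And>w. w \<in> W \<Longrightarrow> (x - y) \<bullet> w = 0"
  shows "orth_proj W x = y"
  unfolding orth_proj_def
  by (rule the1_equality[OF orth_proj_ex1]) (use assms in \<open>auto simp: orthogonal_def\<close>)

lemma inner_orth_proj:
  assumes "subspace W" "w \<in> W"
  shows "orth_proj W x \<bullet> w = x \<bullet> w"
  using orth_proj_orthogonal[OF assms, of x] by (simp add: inner_diff_left)

lemma linear_orth_proj:
  assumes "subspace W"
  shows "linear (orth_proj W)"
proof (rule linearI)
  show "orth_proj W (x + y) = orth_proj W x + orth_proj W y" for x y
    by (rule orth_proj_unique)
       (use assms in \<open>auto simp: orth_proj_in inner_orth_proj inner_diff_left inner_add_left
          intro: subspace_add\<close>)
  show "orth_proj W (c *\<^sub>R x) = c *\<^sub>R orth_proj W x" for c x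
    by (rule orth_proj_unique)
       (use assms in \<open>auto simp: orth_proj_in inner_orth_proj inner_diff_left
          intro: subspace_scale\<close>)
qed

text \<open>Pythagoras for the decomposition of \<open>x\<close> along \<open>W\<close>. It bounds the singular values of
  a projection by 1, and its remainder term vanishes exactly on \<open>W\<close>.\<close>

lemma norm_orth_proj_pythagoras:
  assumes "subspace W"
  shows "(norm x)\<^sup>2 = (norm (orth_proj W x))\<^sup>2 + (norm (x - orth_proj W x))\<^sup>2"
proof -
  have "(x - orth_proj W x) \<bullet> orth_proj W x = 0"
    using assms by (simp add: orth_proj_orthogonal orth_proj_in)
  then show ?thesis
    by (simp add: power2_norm_eq_inner inner_diff_left inner_diff_right inner_commute)
qed

text \<open>Restricting \<open>T\<close> to \<open>V\<close> means composing it with the inclusion of \<open>V\<close>, whose adjoint is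
  the projection onto \<open>V\<close>. So the adjoint of the restriction exists and inherits linearity.\<close>

lemma adjoint_on_eq_orth_proj_adjoint:
  fixes T :: "'a::euclidean_space \<Rightarrow> 'b::euclidean_space"
  assumes "subspace V" "linear T"
  shows "adjoint_on V T y = orth_proj V (adjoint T y)"
  unfolding adjoint_on_def
proof (rule the_equality)
  have *: "T x \<bullet> y = x \<bullet> orth_proj V (adjoint T y)" if "x \<in> V" for x
    using inner_orth_proj[OF assms(1) that, of "adjoint T y"] adjoint_works[OF assms(2), of x y]
    by (simp add: inner_commute)
  then show "orth_proj V (adjoint T y) \<in> V \<and>
      (\<forall>x\<in>V. T x \<bullet> y = x \<bullet> orth_proj V (adjoint T y))"
    using assms by (simp add: orth_proj_in)
  fix z
  assume z: "z \<in> V \<and> (\<forall>x\<in>V. T x \<bullet> y = x \<bullet> z)"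
  have "(adjoint T y - z) \<bullet> x = 0" if "x \<in> V" for x
    using z that adjoint_works[OF assms(2), of x y]
    by (simp add: inner_diff_right inner_commute[of _ x])
  then show "z = orth_proj V (adjoint T y)"
    using orth_proj_unique[OF assms(1), of z "adjoint T y"] z by simp
qed

lemma linear_adjoint_on:
  fixes T :: "'a::euclidean_space \<Rightarrow> 'b::euclidean_space"
  assumes "subspace V" "linear T"
  shows "linear (adjoint_on V T)"
proof -
  have "adjoint_on V T = orth_proj V \<circ> adjoint T"
    using assms by (auto simp: adjoint_on_eq_orth_proj_adjoint)
  then show ?thesis
    using assms by (simp add: adjoint_linear linear_orth_proj linear_compose)
qed

lemma adjoint_on_in:
  fixes T :: "'a::euclidean_space \<Rightarrow> 'b::euclidean_space"
  assumes "subspace V" "linear T"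
  shows "adjoint_on V T y \<in> V"
  using assms by (simp add: adjoint_on_eq_orth_proj_adjoint orth_proj_in)

lemma inner_adjoint_on:
  fixes T :: "'a::euclidean_space \<Rightarrow> 'b::euclidean_space"
  assumes "subspace V" "linear T" "x \<in> V"
  shows "adjoint_on V T y \<bullet> x = y \<bullet> T x"
  using inner_orth_proj[OF assms(1,3), of "adjoint T y"] adjoint_clauses(2)[OF assms(2), of y x]
  by (simp only: adjoint_on_eq_orth_proj_adjoint[OF assms(1,2)])

section \<open>An eigenvector of a symmetric operator\<close>

text \<open>A maximiser \<open>x\<close> of the Rayleigh quotient on the unit sphere is an eigenvector. With \<open>l\<close>
  the maximum, the quadratic form \<open>l * (y \<bullet> y) - f y \<bullet> y\<close> is nonnegative and vanishes at
  \<open>x\<close>; so its derivative at \<open>x\<close>, which is a multiple of \<open>l *\<^sub>R x - f x\<close>, vanishes too.\<close>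

lemma symmetric_operator_has_eigenvector:
  fixes f :: "'a::euclidean_space \<Rightarrow> 'a"
  assumes "subspace S" "linear f" "f ` S \<subseteq> S"
    and sym: "\<And>x y. \<lbrakk>x \<in> S; y \<in> S\<rbrakk> \<Longrightarrow> f x \<bullet> y = x \<bullet> f y"
    and nontriv: "\<not> S \<subseteq> {0}"
  obtains x l where "x \<in> S" "x \<noteq> 0" "f x = l *\<^sub>R x"
proof -
  define K where "K = S \<inter> sphere 0 1"
  obtain u where u: "u \<in> S" "u \<noteq> 0"
    using nontriv by blast
  then have "(1 / norm u) *\<^sub>R u \<in> K"
    using assms(1) by (simp add: K_def subspace_scale)
  moreover have "compact K"
    unfolding K_def using assms(1) by (simp add: closed_Int_compact closed_subspace)
  moreover have "continuous_on K (\<lambda>x. f x \<bullet> x)"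
    using assms(2) by (intro continuous_intros linear_continuous_on linear_linear[THEN iffD2])
      (simp add: linear_conv_bounded_linear)
  ultimately obtain x where x: "x \<in> K" and max: "\<And>y. y \<in> K \<Longrightarrow> f y \<bullet> y \<le> f x \<bullet> x"
    using continuous_attains_sup[of K "\<lambda>x. f x \<bullet> x"] by blast
  define l where "l = f x \<bullet> x"
  have xS: "x \<in> S" and xx: "x \<bullet> x = 1"
    using x by (auto simp: K_def norm_eq_1)
  have nonneg: "0 \<le> l * (y \<bullet> y) - f y \<bullet> y" if "y \<in> S" for y
  proof (cases "y = 0")
    case False
    then have "(1 / norm y) *\<^sub>R y \<in> K"
      using that assms(1) by (simp add: K_def subspace_scale)
    from max[OF this] have "(f y \<bullet> y) / (norm y)\<^sup>2 \<le> l"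
      using assms(2) by (simp add: l_def linear_scale power2_eq_square)
    then show ?thesis
      using False by (simp add: power2_norm_eq_inner divide_le_eq)
  qed (use assms(2) in \<open>simp add: linear_0\<close>)
  define y where "y = l *\<^sub>R x - f x"
  have yS: "y \<in> S"
    using xS assms(1,3) by (auto simp: y_def intro!: subspace_diff subspace_scale)
  define q where "q = l * (y \<bullet> y) - f y \<bullet> y"
  have step: "0 \<le> 2 * t * (y \<bullet> y) + t\<^sup>2 * q" for t
  proof -
    have "x + t *\<^sub>R y \<in> S"
      using xS yS assms(1) by (simp add: subspace_add subspace_scale)
    from nonneg[OF this]
    have "0 \<le> l * (x \<bullet> x) - f x \<bullet> x + 2 * t * (l * (x \<bullet> y) - f x \<bullet> y) + t\<^sup>2 * q"
      using sym[OF xS yS] assms(2)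
      by (simp add: linear_add linear_scale inner_add_left inner_add_right q_def
          algebra_simps power2_eq_square inner_commute)
    also have "l * (x \<bullet> x) - f x \<bullet> x = 0"
      using xx by (simp add: l_def)
    also have "l * (x \<bullet> y) - f x \<bullet> y = y \<bullet> y"
      by (simp add: y_def inner_diff_left)
    finally show ?thesis by simp
  qed
  have "y \<bullet> y = 0"
  proof (rule ccontr)
    assume "y \<bullet> y \<noteq> 0"
    then have pos: "0 < y \<bullet> y" by simp
    have q: "0 \<le> q" using nonneg[OF yS] by (simp add: q_def)
    \<comment> \<open>A small negative \<open>t\<close> makes the linear term win; the summand 1 keeps the divisor
      positive when \<open>q = 0\<close>.\<close>
    define t where "t = - (y \<bullet> y) / (q + 1)"
    have "t * (q + 1) = - (y \<bullet> y)" "t < 0"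
      using q pos by (auto simp: t_def divide_neg_pos)
    then have "2 * t * (y \<bullet> y) + t\<^sup>2 * q = t * (y \<bullet> y) - t\<^sup>2"
      by (simp add: power2_eq_square) algebra
    also have "\<dots> < 0"
      using \<open>t < 0\<close> pos by (smt (verit) mult_neg_pos zero_le_power2)
    finally show False using step[of t] by simp
  qed
  then have "f x = l *\<^sub>R x" by (simp add: y_def)
  moreover have "x \<noteq> 0" using xx by auto
  ultimately show ?thesis using that xS by blast
qed

section \<open>The list of singular values\<close>

lemma inner_singular_space:
  fixes T :: "'a::euclidean_space \<Rightarrow> 'b::euclidean_space"
  assumes "subspace V" "linear T" "x \<in> singular_space V T t" "y \<in> V"
  shows "T x \<bullet> T y = t\<^sup>2 * (x \<bullet> y)"
  using inner_adjoint_on[OF assms(1,2,4), of "T x"] assms(3)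
  by (simp add: singular_space_def)

lemma norm_singular_space:
  fixes T :: "'a::euclidean_space \<Rightarrow> 'b::euclidean_space"
  assumes "subspace V" "linear T" "x \<in> singular_space V T t"
  shows "(norm (T x))\<^sup>2 = t\<^sup>2 * (norm x)\<^sup>2"
  using inner_singular_space[OF assms, of x] assms(3)
  by (simp add: singular_space_def power2_norm_eq_inner)

lemma orthogonal_singular_spaces:
  fixes T :: "'a::euclidean_space \<Rightarrow> 'b::euclidean_space"
  assumes "subspace V" "linear T" "x \<in> singular_space V T s" "y \<in> singular_space V T t"
    and "0 \<le> s" "0 \<le> t" "s \<noteq> t"
  shows "x \<bullet> y = 0"
proof -
  have "s\<^sup>2 * (x \<bullet> y) = t\<^sup>2 * (x \<bullet> y)"
  proof -
    have "x \<in> V" "y \<in> V"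
      using assms(3,4) by (auto simp: singular_space_def)
    then show ?thesis
      using inner_singular_space[OF assms(1,2,3), of y] inner_singular_space[OF assms(1,2,4), of x]
      by (simp only: inner_commute)
  qed
  moreover have "s\<^sup>2 \<noteq> t\<^sup>2"
    using assms(5-7) by (simp add: power2_eq_iff_nonneg)
  ultimately show ?thesis by auto
qed

definition singular_value_set ::
    "'a::euclidean_space set \<Rightarrow> ('a \<Rightarrow> 'b::euclidean_space) \<Rightarrow> real set" where
  "singular_value_set V T = {t. 0 \<le> t \<and> (\<exists>x\<in>singular_space V T t. x \<noteq> 0)}"

text \<open>One eigenvector for each singular value gives an orthogonal, hence independent, family.
  Finiteness matters because the sorted list of an infinite set is a default value.\<close>

lemma finite_singular_value_set:
  fixes T :: "'a::euclidean_space \<Rightarrow> 'b::euclidean_space"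
  assumes "subspace V" "linear T"
  shows "finite (singular_value_set V T)"
proof -
  obtain e where e: "\<And>t. t \<in> singular_value_set V T \<Longrightarrow> e t \<in> singular_space V T t \<and> e t \<noteq> 0"
  proof -
    have "\<forall>t\<in>singular_value_set V T. \<exists>x. x \<in> singular_space V T t \<and> x \<noteq> 0"
      by (auto simp: singular_value_set_def)
    then show thesis using that by (auto dest!: bchoice)
  qed
  have orth: "e s \<bullet> e t = 0"
    if "s \<in> singular_value_set V T" "t \<in> singular_value_set V T" "s \<noteq> t" for s t
    using orthogonal_singular_spaces[OF assms, of "e s" s "e t" t] e that
    by (simp add: singular_value_set_def)
  have "inj_on e (singular_value_set V T)"
    using orth e by (metis inj_onI inner_eq_zero_iff)
  moreover have "finite (e ` singular_value_set V T)"
  proof (rule independent_imp_finite, rule pairwise_orthogonal_independent)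
    show "pairwise orthogonal (e ` singular_value_set V T)"
      using orth by (auto simp: pairwise_def orthogonal_def)
    show "0 \<notin> e ` singular_value_set V T"
      using e by auto
  qed
  ultimately show ?thesis using finite_imageD by blast
qed

text \<open>The spectral theorem for \<open>T\<^sup>* T\<close> on \<open>V\<close>. The orthogonal complement in \<open>V\<close> of all
  eigenspaces is invariant, because \<open>T\<^sup>* T\<close> is symmetric. If it were nonzero it would
  contain an eigenvector, which would be orthogonal to itself. The eigenvalue of that vector is
  nonnegative and so is the square of a singular value.\<close>

lemma span_singular_spaces:
  fixes T :: "'a::euclidean_space \<Rightarrow> 'b::euclidean_space"
  assumes "subspace V" "linear T"
  shows "V \<subseteq> span (\<Union>t\<in>singular_value_set V T. singular_space V T t)"
proof -
  define E where "E = (\<Union>t\<in>singular_value_set V T. singular_space V T t)"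
  define G where "G = (\<lambda>x. adjoint_on V T (T x))"
  define S where "S = {x \<in> V. \<forall>e\<in>E. x \<bullet> e = 0}"
  have EV: "E \<subseteq> V"
    by (auto simp: E_def singular_space_def)
  have linG: "linear G"
    using linear_compose[OF assms(2) linear_adjoint_on[OF assms]] by (simp add: G_def o_def)
  have GV: "G x \<in> V" for x
    using assms by (simp add: G_def adjoint_on_in)
  have inner_G: "G x \<bullet> y = T x \<bullet> T y" if "y \<in> V" for x y
    using assms that by (simp add: G_def inner_adjoint_on)
  have S: "subspace S"
    using assms(1) by (auto simp: S_def subspace_def inner_add_left)
  have GS: "G ` S \<subseteq> S"
  proof
    fix z assume "z \<in> G ` S"
    then obtain x where x: "z = G x" "x \<in> S" by blast
    have "G x \<bullet> e = 0" if e: "e \<in> E" for e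
    proof -
      obtain t where t: "e \<in> singular_space V T t"
        using e by (auto simp: E_def)
      have "G x \<bullet> e = T e \<bullet> T x"
        using e EV inner_G[of e x] by (auto simp: inner_commute)
      also have "\<dots> = t\<^sup>2 * (e \<bullet> x)"
        using inner_singular_space[OF assms t, of x] x by (simp add: S_def)
      finally show ?thesis
        using x e by (simp add: S_def inner_commute)
    qed
    then show "z \<in> S" using x GV by (simp add: S_def)
  qed
  have "S \<subseteq> {0}"
  proof (rule ccontr)
    assume nontriv: "\<not> S \<subseteq> {0}"
    have sym: "G x \<bullet> y = x \<bullet> G y" if "x \<in> S" "y \<in> S" for x y
      using that inner_G[of y x] inner_G[of x y] by (simp add: S_def inner_commute)
    obtain x l where x: "x \<in> S" "x \<noteq> 0" "G x = l *\<^sub>R x"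
      by (rule symmetric_operator_has_eigenvector[OF S linG GS sym nontriv])
    have xV: "x \<in> V" using x by (simp add: S_def)
    have "l * (x \<bullet> x) = T x \<bullet> T x"
      using inner_G[OF xV, of x] x by simp
    then have "0 \<le> l"
      by (metis inner_ge_zero inner_gt_zero_iff mult_le_0_iff not_le x(2) zero_le_mult_iff)
    then have "x \<in> singular_space V T (sqrt l)"
      using x xV by (simp add: singular_space_def G_def)
    then have "x \<in> E"
      using x \<open>0 \<le> l\<close> by (auto simp: E_def singular_value_set_def intro!: exI[of _ "sqrt l"])
    then show False using x by (auto simp: S_def)
  qed
  show ?thesis
  proof
    fix v assume v: "v \<in> V"
    have "span E \<subseteq> V"
      using EV assms(1) by (rule span_minimal)
    then have "orth_proj (span E) v \<in> V"
      using orth_proj_in[of "span E" v] by auto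
    then have "v - orth_proj (span E) v \<in> S"
      using v assms(1) orth_proj_orthogonal[of "span E" _ v]
      by (auto simp: S_def subspace_diff span_base)
    then have "v = orth_proj (span E) v"
      using \<open>S \<subseteq> {0}\<close> by auto
    then show "v \<in> span (\<Union>t\<in>singular_value_set V T. singular_space V T t)"
      using orth_proj_in[of "span E" v] by (simp add: E_def)
  qed
qed

lemma dim_le_sum_dim:
  fixes E :: "'i \<Rightarrow> 'a::euclidean_space set"
  assumes "finite I" "V \<subseteq> span (\<Union>i\<in>I. E i)"
  shows "dim V \<le> (\<Sum>i\<in>I. dim (E i))"
proof -
  obtain B where B: "\<And>i. B i \<subseteq> E i \<and> independent (B i) \<and> E i \<subseteq> span (B i) \<and> card (B i) = dim (E i)"
  proof -
    have "\<forall>i. \<exists>B. B \<subseteq> E i \<and> independent B \<and> E i \<subseteq> span B \<and> card B = dim (E i)"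
    proof
      fix i
      obtain B where "B \<subseteq> E i" "independent B" "E i \<subseteq> span B" "card B = dim (E i)"
        by (rule basis_exists)
      then show "\<exists>B. B \<subseteq> E i \<and> independent B \<and> E i \<subseteq> span B \<and> card B = dim (E i)"
        by (intro exI[of _ B]) simp
    qed
    then obtain B where "\<forall>i. B i \<subseteq> E i \<and> independent (B i) \<and> E i \<subseteq> span (B i) \<and> card (B i) = dim (E i)"
      by (rule choice[THEN exE])
    then show thesis by (intro that[of B]) blast
  qed
  have fin: "finite (\<Union>i\<in>I. B i)"
    using assms(1) B by (auto intro: independent_imp_finite)
  have "(\<Union>i\<in>I. E i) \<subseteq> span (\<Union>i\<in>I. B i)"
  proof (rule UN_least)
    fix i assume "i \<in> I"
    then have "span (B i) \<subseteq> span (\<Union>i\<in>I. B i)"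
      by (intro span_mono) blast
    then show "E i \<subseteq> span (\<Union>i\<in>I. B i)"
      using B by blast
  qed
  then have "V \<subseteq> span (\<Union>i\<in>I. B i)"
    using assms(2) by (metis order.trans span_minimal subspace_span)
  then have "dim V \<le> card (\<Union>i\<in>I. B i)"
    using fin by (rule dim_le_card)
  also have "\<dots> \<le> (\<Sum>i\<in>I. card (B i))"
    using assms(1) by (rule card_UN_le)
  finally show ?thesis using B by simp
qed

lemma singular_values_altdef:
  "singular_values V T = concat (map (\<lambda>t. replicate (dim (singular_space V T t)) t)
     (rev (sorted_list_of_set (singular_value_set V T))))"
  by (simp add: singular_values_def singular_value_set_def)

text \<open>Consequently the positions \<open>0, \<dots>, dim V - 1\<close> of the list carry genuine singular values.\<close>

lemma dim_le_length_singular_values: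
  fixes T :: "'a::euclidean_space \<Rightarrow> 'b::euclidean_space"
  assumes "subspace V" "linear T"
  shows "dim V \<le> length (singular_values V T)"
proof -
  let ?L = "sorted_list_of_set (singular_value_set V T)"
  have fin: "finite (singular_value_set V T)"
    using assms by (rule finite_singular_value_set)
  have "dim V \<le> (\<Sum>t\<in>singular_value_set V T. dim (singular_space V T t))"
    using fin span_singular_spaces[OF assms] by (rule dim_le_sum_dim)
  also have "\<dots> = sum_list (map (\<lambda>t. dim (singular_space V T t)) ?L)"
    using fin by (simp add: sum_list_distinct_conv_sum_set)
  also have "\<dots> = length (singular_values V T)"
    by (simp add: singular_values_altdef length_concat o_def rev_map[symmetric] sum_list_rev)
  finally show ?thesis .
qed

lemma set_singular_values_subset:
  fixes T :: "'a::euclidean_space \<Rightarrow> 'b::euclidean_space"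
  assumes "subspace V" "linear T"
  shows "set (singular_values V T) \<subseteq> singular_value_set V T"
  using finite_singular_value_set[OF assms] by (auto simp: singular_values_altdef)

lemma sorted_concat_replicate:
  assumes "sorted_wrt (\<ge>) xs"
  shows "sorted_wrt (\<ge>) (concat (map (\<lambda>t::real. replicate (m t) t) xs))"
proof -
  have "sorted_wrt (\<ge>) (replicate n t)" for n and t :: real
    by (induction n) auto
  then show ?thesis
    using assms by (induction xs) (auto simp: sorted_wrt_append)
qed

lemma singular_values_decreasing:
  assumes "i \<le> j" "j < length (singular_values V T)"
  shows "singular_values V T ! j \<le> singular_values V T ! i"
proof -
  have "sorted_wrt (\<ge>) (rev (sorted_list_of_set (singular_value_set V T)))"
    by (simp add: sorted_wrt_rev)
  then have "sorted_wrt (\<ge>) (singular_values V T)"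
    unfolding singular_values_altdef by (rule sorted_concat_replicate)
  then show ?thesis
    using assms by (cases "i = j") (auto simp: sorted_wrt_iff_nth_less)
qed

lemma count_list_concat_replicate:
  assumes "distinct xs"
  shows "count_list (concat (map (\<lambda>t. replicate (m t) t) xs)) t = (if t \<in> set xs then m t else 0)"
proof -
  have rep: "count_list (replicate n s) t = (if s = t then n else 0)" for n s
    by (induction n) auto
  show ?thesis
    using assms by (induction xs) (auto simp: rep)
qed

lemma count_singular_values_le:
  "count_list (singular_values V T) t \<le> dim (singular_space V T t)"
  by (simp add: singular_values_altdef count_list_concat_replicate)

section \<open>Singular values of a projection and principal angles\<close>

lemma singular_value_set_orth_proj:
  assumes "subspace U" "subspace V"
  shows "singular_value_set V (orth_proj U) \<subseteq> {0..1}"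
proof
  fix t assume "t \<in> singular_value_set V (orth_proj U)"
  then obtain x where t: "0 \<le> t" and x: "x \<in> singular_space V (orth_proj U) t" "x \<noteq> 0"
    by (auto simp: singular_value_set_def)
  have "t\<^sup>2 * (norm x)\<^sup>2 \<le> 1 * (norm x)\<^sup>2"
    using norm_singular_space[OF assms(2) linear_orth_proj[OF assms(1)] x(1)]
      norm_orth_proj_pythagoras[OF assms(1), of x]
    by simp
  then have "t\<^sup>2 \<le> 1"
    using x(2) by (simp add: mult_le_cancel_right)
  then show "t \<in> {0..1}"
    using t by (simp add: power2_le_iff_abs_le abs_square_le_1)
qed

lemma singular_space_orth_proj_1:
  assumes "subspace U" "subspace V"
  shows "singular_space V (orth_proj U) 1 \<subseteq> U \<inter> V"
proof
  fix x assume x: "x \<in> singular_space V (orth_proj U) 1"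
  have "(norm (x - orth_proj U x))\<^sup>2 = 0"
    using norm_singular_space[OF assms(2) linear_orth_proj[OF assms(1)] x]
      norm_orth_proj_pythagoras[OF assms(1), of x]
    by simp
  then have "x = orth_proj U x" by simp
  then have "x \<in> U" using orth_proj_in[OF assms(1)] by metis
  then show "x \<in> U \<inter> V" using x by (simp add: singular_space_def)
qed

text \<open>The list decreases and is bounded by 1, so if the entry at position \<open>dim (U \<inter> V)\<close> were 1,
  the value 1 would have multiplicity exceeding \<open>dim (U \<inter> V)\<close>. But its eigenspace lies in
  \<open>U \<inter> V\<close>.\<close>

lemma singular_value_Friedrichs_less_1:
  assumes "subspace U" "subspace V"
    and len: "dim (U \<inter> V) < length (singular_values V (orth_proj U))"
  shows "singular_values V (orth_proj U) ! dim (U \<inter> V) < 1"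
proof (rule ccontr)
  define L where "L = singular_values V (orth_proj U)"
  define s where "s = dim (U \<inter> V)"
  assume "\<not> ?thesis"
  then have ge: "1 \<le> L ! s" by (simp add: L_def s_def)
  have len': "s < length L" using len by (simp add: L_def s_def)
  have sub: "set L \<subseteq> {0..1}"
    using set_singular_values_subset[OF assms(2) linear_orth_proj[OF assms(1)]]
      singular_value_set_orth_proj[OF assms(1,2)]
    by (auto simp: L_def)
  have one: "L ! i = 1" if "i \<le> s" for i
  proof -
    have "L ! s \<le> L ! i"
      using singular_values_decreasing[of i s V "orth_proj U"] that len' by (simp add: L_def)
    moreover have "L ! i \<le> 1"
      using sub nth_mem[of i L] that len' by fastforce
    ultimately show ?thesis using ge by simp
  qed
  have "take (Suc s) L = replicate (Suc s) 1"
    by (rule nth_equalityI) (use one len' in \<open>auto simp del: replicate_Suc\<close>)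
  then have "count_list (take (Suc s) L) 1 = Suc s"
    by (metis count_list_eq_length_filter filter_replicate length_replicate)
  then have "Suc s \<le> count_list L 1"
    by (metis append_take_drop_id count_list_append le_add1)
  also have "\<dots> \<le> dim (singular_space V (orth_proj U) 1)"
    unfolding L_def by (rule count_singular_values_le)
  also have "\<dots> \<le> s"
    unfolding s_def using singular_space_orth_proj_1[OF assms(1,2)] by (rule dim_subset)
  finally show False by simp
qed

text \<open>Both positions of the list that define the two angles exist, because
  \<open>dim (U \<inter> V) < dim V\<close> and the list has at least \<open>dim V\<close> entries. The claims on the
  angles thereby become claims on two numbers \<open>0 \<le> d \<le> c < 1\<close>.\<close>

lemma principal_angle_cosines:
  assumes "subspace U" "subspace V" "\<not> V \<subseteq> U"
  obtains c d where "friedrichs_angle U V = arccos c" "largest_principal_angle U V = arccos d"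
    "0 \<le> d" "d \<le> c" "c < 1"
proof
  define L where "L = singular_values V (orth_proj U)"
  define s where "s = dim (U \<inter> V)"
  define c where "c = L ! s"
  define d where "d = L ! (dim V - 1)"
  have "U \<inter> V \<subset> V" using assms(3) by blast
  then have "s < dim V"
    unfolding s_def using assms(1,2)
    by (metis dim_subset inf_le2 le_neq_implies_less less_irrefl order.refl
        subspace_dim_equal subspace_inter)
  moreover have "dim V \<le> length L"
    using dim_le_length_singular_values[OF assms(2) linear_orth_proj[OF assms(1)]]
    by (simp add: L_def)
  ultimately have ind: "s \<le> dim V - 1" "dim V - 1 < length L" "s < length L" by auto
  show "friedrichs_angle U V = arccos c"
    by (simp add: friedrichs_angle_def principal_angle_def c_def L_def s_def)
  show "largest_principal_angle U V = arccos d"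
    by (simp add: largest_principal_angle_def principal_angle_def d_def L_def)
  have "d \<in> set L"
    unfolding d_def using ind(2) by (rule nth_mem)
  then show "0 \<le> d"
    using set_singular_values_subset[OF assms(2) linear_orth_proj[OF assms(1)]]
    by (auto simp: L_def singular_value_set_def)
  show "d \<le> c"
    using singular_values_decreasing[of s "dim V - 1" V "orth_proj U"] ind
    by (simp add: L_def c_def d_def)
  show "c < 1"
    using singular_value_Friedrichs_less_1[OF assms(1,2)] ind(3)
    by (simp add: L_def c_def s_def)
qed

lemma arccos_eq_pi_half_iff:
  assumes "0 \<le> c" "c \<le> 1"
  shows "arccos c = pi / 2 \<longleftrightarrow> c = 0"
  using assms by (metis arccos_0 arccos_cos_eq_abs cos_arccos cos_pi_half neg_le_0_iff_le order_trans zero_le_one)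

theorem proposition4p1:
  fixes U V :: "(real ^ 'n) set"
    and \<theta>F \<theta>p a b cF \<rho>V :: real
  assumes "subspace U" and "subspace V" and "\<not> V \<subseteq> U"
  defines "\<theta>F \<equiv> friedrichs_angle U V"
    and "\<theta>p \<equiv> largest_principal_angle U V"
  defines "a \<equiv> (sin \<theta>F)\<^sup>2"
    and "b \<equiv> (sin \<theta>p)\<^sup>2"
    and "cF \<equiv> cos \<theta>F"
  defines "\<rho>V \<equiv> (b - a) / (a + b)"
  shows "\<theta>F \<in> {0<..pi / 2} \<and> \<theta>p \<in> {\<theta>F..pi / 2} \<and> a \<in> {0<..1} \<and> b \<in> {a..1} \<and>
    cF\<^sup>2 - \<rho>V = a * (2 - a - b) / (a + b) \<and>
    a * (2 - a - b) / (a + b) \<ge> 0 \<and>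
    (cF\<^sup>2 - \<rho>V = 0 \<longleftrightarrow> a = 1 \<and> b = 1) \<and>
    (a = 1 \<and> b = 1 \<longleftrightarrow> \<theta>F = pi / 2 \<and> \<theta>p = pi / 2) \<and>
    (\<theta>F < pi / 2 \<longrightarrow> \<rho>V < cF\<^sup>2)"
proof -
  obtain c d where \<theta>F: "\<theta>F = arccos c" and \<theta>p: "\<theta>p = arccos d"
    and cd: "0 \<le> d" "d \<le> c" "c < 1"
    using principal_angle_cosines[OF assms(1-3)] unfolding \<theta>F_def \<theta>p_def by metis
  have cF: "cF = c" and cosd: "cos \<theta>p = d"
    using cd by (auto simp: cF_def \<theta>F \<theta>p)
  have a: "a = 1 - c\<^sup>2" and b: "b = 1 - d\<^sup>2"
    using cF cosd by (auto simp: a_def b_def cF_def sin_squared_eq)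
  have "c\<^sup>2 < 1" "d\<^sup>2 \<le> c\<^sup>2"
    using cd by (auto simp: power_mono abs_square_less_1)
  then have ab: "0 < a" "a \<le> b" "b \<le> 1" by (auto simp: a b)
  have Fp: "0 < \<theta>F" "\<theta>F \<le> \<theta>p" "\<theta>p \<le> pi / 2"
    using cd arccos_less_arccos[of c 1] arccos_le_arccos[of d c] arccos_le_pi2[of d]
    by (auto simp: \<theta>F \<theta>p)
  have diff: "cF\<^sup>2 - \<rho>V = a * (2 - a - b) / (a + b)"
  proof -
    have "cF\<^sup>2 = 1 - a" by (simp add: cF a)
    then have "cF\<^sup>2 - \<rho>V = ((1 - a) * (a + b) - (b - a)) / (a + b)"
      using ab by (simp add: \<rho>V_def diff_divide_distrib)
    also have "(1 - a) * (a + b) - (b - a) = a * (2 - a - b)"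
      by algebra
    finally show ?thesis .
  qed
  have nonneg: "a * (2 - a - b) / (a + b) \<ge> 0"
    using ab by simp
  have zero: "cF\<^sup>2 - \<rho>V = 0 \<longleftrightarrow> a = 1 \<and> b = 1"
    unfolding diff using ab by auto
  have angles: "a = 1 \<longleftrightarrow> \<theta>F = pi / 2" "b = 1 \<longleftrightarrow> \<theta>p = pi / 2"
    using cd arccos_eq_pi_half_iff[of c] arccos_eq_pi_half_iff[of d] by (auto simp: a b \<theta>F \<theta>p)
  have "\<rho>V < cF\<^sup>2" if "\<theta>F < pi / 2"
    using that zero angles(1) diff nonneg by linarith
  then show ?thesis
    using Fp ab diff nonneg zero angles by auto
qed

end
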